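(* Let $G$ be any group and let $\alpha$ be an automorphism of $G$ of finite order $o$. Then the following hold: (1) For any distinct primes $p,q$, $\alpha$ has a cycle whose length is divisible by $p^{\nu_p(o)}q^{\nu_q(o)}$. (2) If the order of $\alpha$ is divisible by at most two distinct primes, then $\alpha$ satisfies the RCC, i.e. $\alpha$ has a cycle whose length equals $o$.
   Context: $\nu_p(n)$ denotes the $p$-adic valuation of the positive integer $n$ (the exponent of $p$ in $n$). Cycles of $\alpha$ are the cycles of $\alpha$ as a permutation of the underlying set of $G$ (fixed points being cycles of length $1$); since $\alpha$ has finite order, all cycles are finite. A permutation of finite order satisfies the regular cycle condition (RCC) if it has a cycle whose length equals its order. *)

theory Defs
  imports
    "HOL-Algebra.Bij"
    "HOL-Algebra.Multiplicative_Group"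
    "HOL-Combinatorics.Orbits"
    "HOL-Computational_Algebra.Primes"
begin

text \<open>
  A cycle is represented by its underlying set of points, so its length is the cardinality of that
  set. Fixed points give cycles of length 1, since \<^const>\<open>orbit\<close> consists of the
  iterates with positive exponent. \<^const>\<open>cyclic_on\<close> forces a point of the set to be one
  of its own positive iterates, so infinite cycles do not occur here and \<^const>\<open>card\<close>
  never takes its default value 0.
\<close>

definition cycles :: "'a set \<Rightarrow> ('a \<Rightarrow> 'a) \<Rightarrow> 'a set set" where
  "cycles S f = {C. C \<subseteq> S \<and> cyclic_on f C}"

text \<open>
  \<^const>\<open>group.ord\<close> is 0 exactly for elements of infinite order, so positivity expresses
  finite order.
\<close>

definition regular_cycle_condition :: "'a set \<Rightarrow> ('a \<Rightarrow> 'a) \<Rightarrow> bool" where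
  "regular_cycle_condition S f \<longleftrightarrow>
     f \<in> carrier (BijGroup S) \<and> group.ord (BijGroup S) f > 0 \<and>
     (\<exists>C\<in>cycles S f. card C = group.ord (BijGroup S) f)"

end

theory Submission
  imports Defs
begin

text \<open>
  If a prime \<open>p\<close> divides the order \<open>n\<close> of \<open>\<alpha>\<close>, then the length of the cycle of \<open>x\<close> is divisible by
  the full power of \<open>p\<close> in \<open>n\<close> as soon as \<open>x\<close> is not fixed by \<open>\<alpha>\<close> to the power \<open>n div p\<close>. The fixed
  points of that nontrivial automorphism form a proper subgroup, and a group is not the union of
  two proper subgroups, so two primes can be treated by a single point \<open>x\<close>.
\<close>

section \<open>Cycle lengths and prime powers\<close>

text \<open>The cardinality is the least positive return time \<open>m\<close> of \<open>x\<close>.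
  Iterates at \<open>x\<close> depend only on the exponent modulo \<open>m\<close>, and minimality
  of \<open>m\<close> rules out a return at a nonzero remainder.\<close>

lemma card_orbit_dvd_iff:
  assumes "x \<in> orbit f x"
  shows "card (orbit f x) dvd n \<longleftrightarrow> (f ^^ n) x = x"
proof -
  define m where "m = funpow_dist1 f x x"
  have card: "card (orbit f x) = m"
    unfolding m_def by (subst orbit_conv_funpow_dist1[OF assms])
      (simp add: card_image[OF inj_on_funpow_dist1[OF assms]])
  have m: "(f ^^ m) x = x" "m > 0"
    unfolding m_def using funpow_dist1_prop[OF assms] by auto
  have "(f ^^ n) x = (f ^^ (n mod m)) x"
    using m(1) by (simp add: funpow_mod_eq)
  moreover have "(f ^^ (n mod m)) x = x \<longleftrightarrow> n mod m = 0"
  proof (cases "n mod m = 0")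
    case False
    then have "(f ^^ (n mod m)) x \<noteq> x"
      using m(2) unfolding m_def by (intro funpow_dist1_least) auto
    with False show ?thesis by simp
  qed simp
  ultimately show ?thesis
    unfolding card by (simp add: dvd_eq_mod_eq_0)
qed

text \<open>In \<open>n = c * d\<close> the prime \<open>p\<close> cannot divide the cofactor
  \<open>d\<close>, since otherwise \<open>c\<close> would divide \<open>n div p\<close>. So the
  whole power of \<open>p\<close> sits in \<open>c\<close>, which will be a cycle length.\<close>

lemma prime_power_multiplicity_dvd:
  fixes p c n :: nat
  assumes "prime p" "p dvd n" "c dvd n" "\<not> c dvd n div p"
  shows "p ^ multiplicity p n dvd c"
proof -
  obtain d where d: "n = c * d"
    using assms(3) by blast
  have "\<not> p dvd d"
  proof
    assume "p dvd d"
    then have "n div p = c * (d div p)"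
      unfolding d by (simp add: div_mult_swap)
    with assms(4) show False by simp
  qed
  then have "coprime (p ^ multiplicity p n) d"
    using assms(1) by (simp add: prime_imp_coprime)
  moreover have "p ^ multiplicity p n dvd c * d"
    unfolding d by (rule multiplicity_dvd)
  ultimately show ?thesis
    by (simp add: coprime_dvd_mult_left_iff)
qed

section \<open>Proper subgroups and fixed points\<close>

text \<open>If \<open>H\<close> and \<open>K\<close> cover the group, an element \<open>a\<close>
  outside \<open>H\<close> lies in \<open>K\<close> and an element \<open>b\<close> outside
  \<open>K\<close> lies in \<open>H\<close>. Whichever subgroup contains the product, cancelling the
  factor known to be in it forces the other factor in as well.\<close>

lemma (in group) not_union_of_two_proper_subgroups:
  assumes "subgroup H G" "subgroup K G" "H \<noteq> carrier G" "K \<noteq> carrier G"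
  shows "\<exists>x\<in>carrier G. x \<notin> H \<and> x \<notin> K"
proof (rule ccontr)
  assume "\<not> ?thesis"
  then have cover: "x \<in> H \<or> x \<in> K" if "x \<in> carrier G" for x
    using that by blast
  have sub: "H \<subseteq> carrier G" "K \<subseteq> carrier G"
    using assms(1,2) by (auto dest: subgroup.subset)
  obtain a b where ab: "a \<in> carrier G" "a \<notin> H" "b \<in> carrier G" "b \<notin> K"
    using sub assms(3,4) by blast
  then have "a \<in> K" "b \<in> H"
    using cover by blast+
  have "a \<otimes> b \<in> H \<or> a \<otimes> b \<in> K"
    using cover ab by simp
  then show False
  proof
    assume "a \<otimes> b \<in> H"
    then have "(a \<otimes> b) \<otimes> inv b \<in> H"
      using \<open>b \<in> H\<close> assms(1) by (blast intro: subgroup.m_closed subgroup.m_inv_closed)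
    moreover have "(a \<otimes> b) \<otimes> inv b = a"
      using ab by (simp add: m_assoc)
    ultimately show False
      using ab by simp
  next
    assume "a \<otimes> b \<in> K"
    then have "inv a \<otimes> (a \<otimes> b) \<in> K"
      using \<open>a \<in> K\<close> assms(2) by (blast intro: subgroup.m_closed subgroup.m_inv_closed)
    moreover have "inv a \<otimes> (a \<otimes> b) = b"
      using ab by (simp add: m_assoc[symmetric])
    ultimately show False
      using ab by simp
  qed
qed

lemma (in group) subgroup_fixed_points:
  assumes "h \<in> hom G G"
  shows "subgroup {x \<in> carrier G. h x = x} G"
proof -
  interpret group_hom G G h
    by unfold_locales (rule assms)
  show ?thesis
    by (rule subgroupI) (auto intro: exI[of _ \<one>])
qed

lemma (in group) funpow_hom:
  assumes "h \<in> hom G G"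
  shows "h ^^ n \<in> hom G G"
proof (induction n)
  case 0
  show ?case by (simp add: hom_def)
next
  case (Suc n)
  then show ?case
    using assms by (auto simp: hom_def Pi_iff)
qed

section \<open>Powers and orders in \<open>BijGroup\<close>\<close>

text \<open>The restriction is there because elements of \<open>BijGroup S\<close> are
  \<open>undefined\<close> outside \<open>S\<close>, where a plain iterate need not be.\<close>

lemma BijGroup_nat_pow:
  assumes "f \<in> Bij S"
  shows "f [^]\<^bsub>BijGroup S\<^esub> (n::nat) = restrict (f ^^ n) S"
proof (induction n)
  case 0
  show ?case by (simp add: BijGroup_def id_def)
next
  case (Suc n)
  interpret group "BijGroup S"
    by (rule group_BijGroup)
  have "f \<in> carrier (BijGroup S)"
    using assms by (simp add: BijGroup_def)
  then have "restrict (f ^^ n) S \<in> Bij S"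
    using nat_pow_closed[of f n] unfolding Suc by (simp add: BijGroup_def)
  have "f [^]\<^bsub>BijGroup S\<^esub> Suc n = restrict (f ^^ n) S \<otimes>\<^bsub>BijGroup S\<^esub> f"
    by (simp only: nat_pow_Suc Suc)
  also have "\<dots> = compose S (restrict (f ^^ n) S) f"
    using assms \<open>restrict (f ^^ n) S \<in> Bij S\<close> by (simp add: BijGroup_def)
  \<comment> \<open>The new factor stands on the right, so \<open>f\<close> acts first; as it maps
    \<open>S\<close> into itself, the inner restriction is harmless.\<close>
  also have "\<dots> = restrict (f ^^ Suc n) S"
  proof
    fix x
    show "compose S (restrict (f ^^ n) S) f x = restrict (f ^^ Suc n) S x"
      using Bij_imp_funcset[OF assms]
      by (cases "x \<in> S") (auto simp: compose_def funpow_Suc_right simp del: funpow.simps)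
  qed
  finally show ?case .
qed

text \<open>The counterpart, for all points of \<open>S\<close> at once, of
  \<open>card_orbit_dvd_iff\<close> at a single point.\<close>

lemma ord_BijGroup_dvd_iff:
  assumes "f \<in> Bij S"
  shows "group.ord (BijGroup S) f dvd n \<longleftrightarrow> (\<forall>x\<in>S. (f ^^ n) x = x)"
proof -
  have carrier: "f \<in> carrier (BijGroup S)" and one: "\<one>\<^bsub>BijGroup S\<^esub> = (\<lambda>x\<in>S. x)"
    using assms by (simp_all add: BijGroup_def)
  have "group.ord (BijGroup S) f dvd n \<longleftrightarrow> restrict (f ^^ n) S = (\<lambda>x\<in>S. x)"
    by (simp only: group.pow_eq_id[OF group_BijGroup carrier, symmetric]
        BijGroup_nat_pow[OF assms] one)
  also have "\<dots> \<longleftrightarrow> (\<forall>x\<in>S. (f ^^ n) x = x)"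
    by (metis restrict_apply' restrict_ext)
  finally show ?thesis .
qed

text \<open>\<open>AutoGroup G\<close> differs from \<open>BijGroup (carrier G)\<close> only in its
  carrier, while the order depends only on powers and the unit.\<close>

lemma (in group) ord_AutoGroup:
  "group.ord (AutoGroup G) f = group.ord (BijGroup (carrier G)) f"
  unfolding group.ord_def[OF AutoGroup] group.ord_def[OF group_BijGroup]
  by (simp add: AutoGroup_def nat_pow_def)

section \<open>Cycles of a bijection of finite order\<close>

context
  fixes S :: "'a set" and f :: "'a \<Rightarrow> 'a"
  assumes f: "f \<in> Bij S" and fin: "group.ord (BijGroup S) f > 0"
begin

lemma self_in_orbit_Bij:
  assumes "x \<in> S"
  shows "x \<in> orbit f x"
proof -
  have "(f ^^ group.ord (BijGroup S) f) x = x"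
    using ord_BijGroup_dvd_iff[OF f, THEN iffD1, OF dvd_refl] assms by (rule bspec)
  with fin show ?thesis
    unfolding orbit_altdef mem_Collect_eq by metis
qed

lemma card_orbit_dvd_ord:
  assumes "x \<in> S"
  shows "card (orbit f x) dvd group.ord (BijGroup S) f"
proof -
  have "(f ^^ group.ord (BijGroup S) f) x = x"
    using ord_BijGroup_dvd_iff[OF f, THEN iffD1, OF dvd_refl] assms by (rule bspec)
  then show ?thesis
    unfolding card_orbit_dvd_iff[OF self_in_orbit_Bij[OF assms]] .
qed

lemma orbit_in_cycles:
  assumes "x \<in> S"
  shows "orbit f x \<in> cycles S f"
proof -
  have "y \<in> S" if "y \<in> orbit f x" for y
    using that by induction (use assms Bij_imp_funcset[OF f] in auto)
  moreover have "cyclic_on f (orbit f x)"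
    using self_in_orbit_Bij[OF assms] by (intro cyclic_on_singleI) auto
  ultimately show ?thesis
    by (auto simp: cycles_def)
qed

end

section \<open>One point for two primes\<close>

text \<open>The primes may coincide or fail to divide \<open>n\<close>, so that orders with fewer
  than two prime divisors are covered too.\<close>

lemma (in group) ex_orbit_prime_powers_dvd:
  fixes p q :: nat and f :: "'a \<Rightarrow> 'a"
  defines "n \<equiv> group.ord (BijGroup (carrier G)) f"
  assumes f: "f \<in> auto G" and n: "n > 0" and pq: "prime p" "prime q"
  shows "\<exists>x\<in>carrier G. p ^ multiplicity p n dvd card (orbit f x) \<and>
                         q ^ multiplicity q n dvd card (orbit f x)"
proof -
  have hom: "f \<in> hom G G" and Bij: "f \<in> Bij (carrier G)"
    using f by (auto simp: auto_def)
  define F where "F r = {x \<in> carrier G. (f ^^ (n div r)) x = x}" for r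
  have sub: "subgroup (F r) G" for r
    unfolding F_def by (rule subgroup_fixed_points[OF funpow_hom[OF hom]])
  have proper: "F r \<noteq> carrier G" if "prime r" "r dvd n" for r
  proof
    assume "F r = carrier G"
    \<comment> \<open>Otherwise the power \<open>n div r\<close> of \<open>f\<close> would be the
      identity on the carrier.\<close>
    then have "n dvd n div r"
      unfolding n_def by (subst ord_BijGroup_dvd_iff[OF Bij]) (auto simp: F_def n_def)
    moreover have "0 < n div r" "n div r < n"
      using that n prime_gt_1_nat[of r] by (auto simp: div_greater_zero_iff dvd_imp_le)
    ultimately show False
      by (simp add: nat_dvd_not_less)
  qed
  have dvd: "r ^ multiplicity r n dvd card (orbit f x)"
    if "prime r" "x \<in> carrier G" "r dvd n \<Longrightarrow> x \<notin> F r" for r x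
  proof (cases "r dvd n")
    case True
    have "\<not> card (orbit f x) dvd n div r"
      using that True self_in_orbit_Bij[OF Bij n[unfolded n_def]]
      by (simp add: card_orbit_dvd_iff F_def)
    with True that(1,2) show ?thesis
      using card_orbit_dvd_ord[OF Bij n[unfolded n_def]]
      by (intro prime_power_multiplicity_dvd) (auto simp: n_def)
  qed (simp add: not_dvd_imp_multiplicity_0)
  have "\<exists>x\<in>carrier G. (p dvd n \<longrightarrow> x \<notin> F p) \<and> (q dvd n \<longrightarrow> x \<notin> F q)"
  proof (cases "p dvd n \<and> q dvd n")
    case True
    then show ?thesis
      using not_union_of_two_proper_subgroups[OF sub sub] proper pq by blast
  next
    \<comment> \<open>At most one of the two conditions is left, and a single proper subgroup misses
      some point; with no condition left, the unit will do.\<close>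
    case False
    have "F r \<subseteq> carrier G" for r
      by (auto simp: F_def)
    with False show ?thesis
      using proper pq one_closed by blast
  qed
  with dvd pq show ?thesis
    by blast
qed

theorem theorem3p2:
  fixes G :: "('a, 'b) monoid_scheme" and \<alpha> :: "'a \<Rightarrow> 'a" and ord_\<alpha> :: nat
  assumes "group G"
    and "\<alpha> \<in> carrier (AutoGroup G)"
    and "ord_\<alpha> = group.ord (AutoGroup G) \<alpha>"
    and "ord_\<alpha> > 0"
  shows "(\<forall>p q :: nat. prime p \<and> prime q \<and> p \<noteq> q \<longrightarrow>
            (\<exists>C\<in>cycles (carrier G) \<alpha>.
               p ^ multiplicity p ord_\<alpha> * q ^ multiplicity q ord_\<alpha> dvd card C)) \<and>
         (card {p :: nat. prime p \<and> p dvd ord_\<alpha>} \<le> 2 \<longrightarrow>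
            regular_cycle_condition (carrier G) \<alpha> \<and>
            (\<exists>C\<in>cycles (carrier G) \<alpha>. card C = ord_\<alpha>))"
proof -
  interpret group G by fact
  have auto: "\<alpha> \<in> auto G"
    using assms(2) by (simp add: AutoGroup_def)
  then have Bij: "\<alpha> \<in> Bij (carrier G)"
    by (simp add: auto_def)
  have ord: "ord_\<alpha> = group.ord (BijGroup (carrier G)) \<alpha>"
    using assms(3) by (simp add: ord_AutoGroup)
  note pos = assms(4)[unfolded ord]
  note ex = ex_orbit_prime_powers_dvd[OF auto pos, folded ord]
  note cyc = orbit_in_cycles[OF Bij pos]
  have "\<exists>C\<in>cycles (carrier G) \<alpha>. p ^ multiplicity p ord_\<alpha> * q ^ multiplicity q ord_\<alpha> dvd card C"
    if pq: "prime p" "prime q" "p \<noteq> q" for p q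
  proof -
    obtain x where x: "x \<in> carrier G"
      "p ^ multiplicity p ord_\<alpha> dvd card (orbit \<alpha> x)"
      "q ^ multiplicity q ord_\<alpha> dvd card (orbit \<alpha> x)"
      using ex[OF pq(1,2)] by blast
    have "coprime (p ^ multiplicity p ord_\<alpha>) (q ^ multiplicity q ord_\<alpha>)"
      using pq by (simp add: primes_coprime)
    with x(2,3) have "p ^ multiplicity p ord_\<alpha> * q ^ multiplicity q ord_\<alpha> dvd card (orbit \<alpha> x)"
      by (rule divides_mult)
    with cyc[OF x(1)] show ?thesis
      by blast
  qed
  moreover have "\<exists>C\<in>cycles (carrier G) \<alpha>. card C = ord_\<alpha>"
    if card: "card {p :: nat. prime p \<and> p dvd ord_\<alpha>} \<le> 2"
  proof -
    let ?P = "{p :: nat. prime p \<and> p dvd ord_\<alpha>}"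
    \<comment> \<open>Needed because \<open>card\<close> is also 0 on infinite sets.\<close>
    have "finite ?P"
      using assms(4) by (intro finite_subset[OF _ finite_divisors_nat]) auto
    \<comment> \<open>Missing primes are filled up: by 2 if there is no prime divisor, by repetition
      if there is one.\<close>
    then have "\<exists>p q. prime p \<and> prime q \<and> ?P \<subseteq> {p, q}"
    proof -
      consider "card ?P = 0" | "card ?P = 1" | "card ?P = 2"
        using card by linarith
      then show ?thesis
      proof cases
        case 1
        with \<open>finite ?P\<close> have "?P = {}" by simp
        with two_is_prime_nat show ?thesis by blast
      next
        case 2
        then obtain p where "?P = {p}" by (auto simp: card_1_singleton_iff)
        then show ?thesis by blast
      next
        case 3
        then obtain p q where "?P = {p, q}" by (auto simp: card_2_iff)
        then show ?thesis by blast
      qed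
    qed
    then obtain p q where pq: "prime p" "prime q" "?P \<subseteq> {p, q}"
      by blast
    obtain x where x: "x \<in> carrier G"
      "p ^ multiplicity p ord_\<alpha> dvd card (orbit \<alpha> x)"
      "q ^ multiplicity q ord_\<alpha> dvd card (orbit \<alpha> x)"
      using ex[OF pq(1,2)] by blast
    have dvd: "card (orbit \<alpha> x) dvd ord_\<alpha>"
      unfolding ord by (rule card_orbit_dvd_ord[OF Bij pos x(1)])
    \<comment> \<open>Valuations are compared prime by prime; each prime divisor of the order is
      \<open>p\<close> or \<open>q\<close>.\<close>
    have "ord_\<alpha> dvd card (orbit \<alpha> x)"
    proof (rule multiplicity_le_imp_dvd)
      fix r :: nat
      assume r: "prime r"
      show "multiplicity r ord_\<alpha> \<le> multiplicity r (card (orbit \<alpha> x))"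
      proof (cases "r dvd ord_\<alpha>")
        case True
        then have "r ^ multiplicity r ord_\<alpha> dvd card (orbit \<alpha> x)"
          using r pq(3) x(2,3) by blast
        \<comment> \<open>By convention \<open>multiplicity r 0\<close> is 0, so a zero length has
          to be excluded.\<close>
        moreover have "card (orbit \<alpha> x) \<noteq> 0"
          using dvd assms(4) by auto
        ultimately show ?thesis
          using r by (intro multiplicity_geI) (auto simp: prime_gt_Suc_0_nat)
      qed (simp add: not_dvd_imp_multiplicity_0)
    qed (use assms(4) in simp)
    with dvd cyc[OF x(1)] show ?thesis
      by (auto intro: dvd_antisym)
  qed
  moreover have "\<alpha> \<in> carrier (BijGroup (carrier G))"
    using Bij by (simp add: BijGroup_def)
  ultimately show ?thesis
    unfolding regular_cycle_condition_def ord[symmetric] using assms(4) by blast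
qed

end
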